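(* Let $G=\langle g_1,\dots,g_n\rangle$ be a finite group generated by $n$ pairwise distinct elements $g_1,\dots,g_n\in G$. Then there exists a cubic graph $\Gamma$ with $\mathrm{Aut}(\Gamma)\cong G$. Moreover, if $n=2$ the graph $\Gamma$ can be taken to have $6|G|$ nodes, and if $n>2$ it can be taken to have $(2n+6)|G|$ nodes.
   Context: A cubic graph is a finite undirected graph in which every node (graph vertex) has degree $3$. $\mathrm{Aut}(\Gamma)$ is the group of graph automorphisms of $\Gamma$, i.e. permutations of the nodes preserving adjacency. *)

theory Defs
  imports
    "HOL-Algebra.Bij"
    "HOL-Algebra.Generated_Groups"
    "Graph_Theory.Pair_Digraph"
begin

text \<open>
  A \<^locale>\<open>pair_graph\<close> is finite, symmetric, loop-free and has no parallel arcs, i.e. it is a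
  finite simple undirected graph in which the edge uv is represented by the two arcs (u, v) and
  (v, u). The out-degree of a node is therefore its degree. The null graph, which would be
  cubic vacuously, is excluded.
\<close>

definition cubic_graph :: "'v pair_pre_digraph \<Rightarrow> bool" where
  "cubic_graph \<Gamma> \<longleftrightarrow>
     pair_graph \<Gamma> \<and> pverts \<Gamma> \<noteq> {} \<and> (\<forall>v \<in> pverts \<Gamma>. out_degree (with_proj \<Gamma>) v = 3)"

definition graph_automorphisms :: "'v pair_pre_digraph \<Rightarrow> ('v \<Rightarrow> 'v) set" where
  "graph_automorphisms \<Gamma> =
     {f \<in> Bij (pverts \<Gamma>). \<forall>u \<in> pverts \<Gamma>. \<forall>v \<in> pverts \<Gamma>.
        (u, v) \<in> parcs \<Gamma> \<longleftrightarrow> (f u, f v) \<in> parcs \<Gamma>}"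

text \<open>
  As in \<^const>\<open>BijGroup\<close>, permutations are extensional functions (\<^const>\<open>undefined\<close> outside
  the node set), so that each automorphism is represented exactly once.
\<close>

definition Aut_graph :: "'v pair_pre_digraph \<Rightarrow> ('v \<Rightarrow> 'v) monoid" where
  "Aut_graph \<Gamma> = BijGroup (pverts \<Gamma>)\<lparr>carrier := graph_automorphisms \<Gamma>\<rparr>"

lemma group_Aut_graph: "group (Aut_graph \<Gamma>)"
proof -
  let ?S = "pverts \<Gamma>"
  have "subgroup (graph_automorphisms \<Gamma>) (BijGroup ?S)"
  proof (rule group.subgroupI [OF group_BijGroup])
    show "graph_automorphisms \<Gamma> \<subseteq> carrier (BijGroup ?S)"
      by (auto simp: graph_automorphisms_def BijGroup_def)
    have "(\<lambda>x\<in>?S. x) \<in> graph_automorphisms \<Gamma>"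
      by (auto simp: graph_automorphisms_def id_Bij)
    then show "graph_automorphisms \<Gamma> \<noteq> {}" by blast
  next
    fix f assume f: "f \<in> graph_automorphisms \<Gamma>"
    then have fB: "f \<in> Bij ?S" by (simp add: graph_automorphisms_def)
    then have bij: "bij_betw f ?S ?S" by (simp add: Bij_def)
    have inv: "restrict (inv_into ?S f) ?S \<in> Bij ?S" by (rule restrict_inv_into_Bij [OF fB])
    have "(u, v) \<in> parcs \<Gamma> \<longleftrightarrow> (inv_into ?S f u, inv_into ?S f v) \<in> parcs \<Gamma>"
      if "u \<in> ?S" "v \<in> ?S" for u v
    proof -
      have "inv_into ?S f u \<in> ?S" "inv_into ?S f v \<in> ?S"
        using bij that by (auto simp: bij_betw_def intro: inv_into_into)
      moreover have "f (inv_into ?S f u) = u" "f (inv_into ?S f v) = v"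
        using bij that by (auto simp: bij_betw_inv_into_right)
      ultimately show ?thesis using f by (auto simp: graph_automorphisms_def)
    qed
    then show "inv\<^bsub>BijGroup ?S\<^esub> f \<in> graph_automorphisms \<Gamma>"
      using inv by (simp add: inv_BijGroup [OF fB] graph_automorphisms_def)
  next
    fix f g assume fg: "f \<in> graph_automorphisms \<Gamma>" "g \<in> graph_automorphisms \<Gamma>"
    then have B: "f \<in> Bij ?S" "g \<in> Bij ?S" by (simp_all add: graph_automorphisms_def)
    have "g u \<in> ?S" if "u \<in> ?S" for u
      using Bij_imp_funcset [OF B(2)] that by auto
    then have "compose ?S f g \<in> graph_automorphisms \<Gamma>"
      using fg B by (simp add: graph_automorphisms_def compose_Bij compose_eq)
    then show "f \<otimes>\<^bsub>BijGroup ?S\<^esub> g \<in> graph_automorphisms \<Gamma>"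
      using B by (simp add: BijGroup_def)
  qed
  from subgroup.subgroup_is_group [OF this group_BijGroup]
  show ?thesis by (simp add: Aut_graph_def)
qed

end

theory Submission
  imports Defs
begin

text \<open>
  The graphs are regular coverings of small cubic base graphs. Give each oriented edge (dart) of a
  base graph a voltage in \<open>G\<close>, reversed darts having inverse voltages. The derived graph
  has the nodes \<open>(k, x)\<close> with a site \<open>k\<close> of the base and \<open>x \<in> G\<close>, and a dart from
  \<open>k\<close> to \<open>l\<close> with voltage \<open>v\<close> joins \<open>(k, x)\<close> to \<open>(l, x v)\<close>. Left multiplication
  acts on it by automorphisms. Conversely, suppose that every automorphism has the form
  \<open>(k, x) \<mapsto> (k, f x)\<close> with one map \<open>f\<close> for all sites. Then \<open>f\<close> commutes with right
  multiplication by each voltage, so with all right multiplications if the voltages generate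
  \<open>G\<close>, and hence is a left multiplication. This is \<open>Aut_derived\<close>. It remains to find
  bases in which the shape of the graph reveals the site of a node, whatever relations hold
  in \<open>G\<close>.

  The main base is a triangle \<open>T1, Q 0, T3\<close> with a ladder of height \<open>m\<close> on top of it:
  rails \<open>Q 0, \<dots>, Q m\<close> and \<open>R 0, \<dots>, R m\<close>, whose last sites are adjacent; rungs
  \<open>Q j \<midarrow> R j\<close> with voltage \<open>c j\<close> for \<open>1 \<le> j \<le> m\<close>; and \<open>R 0\<close> adjacent to
  \<open>T1\<close> with voltage \<open>1\<close> and to \<open>T3\<close>, with voltage \<open>a\<close> from \<open>T3\<close> to
  \<open>R 0\<close>. It has \<open>2 m + 4\<close> sites.
  In the derived graph all triangles lie over \<open>T1, Q 0, T3\<close>, and the nodes over \<open>R 0\<close>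
  are the ones outside of triangles that have two neighbours in triangles. From this start
  an automorphism can be followed up both rails; it acts by some \<open>f\<close> on \<open>Q\<close> and by some
  \<open>h\<close> on \<open>R\<close> (\<open>ladder_rigid\<close>). A rung below the top with voltage \<open>1\<close> forces \<open>h = f\<close>.
  For \<open>m = 1\<close> there is no room for such a rung; but then \<open>h x\<close> is \<open>f x\<close> or \<open>f x\<close>
  times \<open>c 1\<close> at the top, and \<open>f x\<close> or \<open>f x\<close> times \<open>a\<close> at the bottom, so that
  \<open>a \<noteq> c 1\<close> suffices.

  Two generators other than \<open>1\<close> thus give \<open>m = 1\<close> and \<open>6\<close> sites. For \<open>n\<close> generators,
  \<open>m = n + 1\<close> leaves space for a rung with voltage \<open>1\<close> and for all generators, and there are
  \<open>2 n + 6\<close> sites. If one of two generators is \<open>1\<close> and the other is \<open>u\<close>, then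
  \<open>u\<close> and its inverse are used, which are distinct unless \<open>G\<close> has order two. For order two, and for
  the trivial group in the first part, special bases are used in which the number of
  walks of a fixed length that end in a triangle is different for any two sites.
\<close>

section \<open>Automorphisms of graphs\<close>

lemma automorphism_bij:
  "\<phi> \<in> graph_automorphisms \<Gamma> \<Longrightarrow> bij_betw \<phi> (pverts \<Gamma>) (pverts \<Gamma>)"
  by (simp add: graph_automorphisms_def Bij_def)

lemma automorphism_arc_iff:
  assumes "\<phi> \<in> graph_automorphisms \<Gamma>" "u \<in> pverts \<Gamma>" "v \<in> pverts \<Gamma>"
  shows "(\<phi> u, \<phi> v) \<in> parcs \<Gamma> \<longleftrightarrow> (u, v) \<in> parcs \<Gamma>"
  using assms by (simp add: graph_automorphisms_def)

lemma automorphism_neighbours: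
  assumes wf: "pair_wf_digraph \<Gamma>" and \<phi>: "\<phi> \<in> graph_automorphisms \<Gamma>" and v: "v \<in> pverts \<Gamma>"
  shows "parcs \<Gamma> `` {\<phi> v} = \<phi> ` (parcs \<Gamma> `` {v})"
proof -
  interpret pair_wf_digraph \<Gamma> by (rule wf)
  show ?thesis
  proof (intro equalityI subsetI)
    fix u assume "u \<in> parcs \<Gamma> `` {\<phi> v}"
    then have u: "(\<phi> v, u) \<in> parcs \<Gamma>" by simp
    then have "u \<in> pverts \<Gamma>" by (rule in_arcsD2)
    then obtain w where "w \<in> pverts \<Gamma>" "u = \<phi> w"
      using automorphism_bij[OF \<phi>] by (auto simp: bij_betw_def)
    then show "u \<in> \<phi> ` (parcs \<Gamma> `` {v})"
      using u automorphism_arc_iff[OF \<phi> v] by auto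
  next
    fix u assume "u \<in> \<phi> ` (parcs \<Gamma> `` {v})"
    then obtain w where w: "(v, w) \<in> parcs \<Gamma>" "u = \<phi> w" by auto
    then show "u \<in> parcs \<Gamma> `` {\<phi> v}"
      using automorphism_arc_iff[OF \<phi> v in_arcsD2[OF w(1)]] by auto
  qed
qed

definition in_triangle :: "'v pair_pre_digraph \<Rightarrow> 'v \<Rightarrow> bool" where
  "in_triangle \<Gamma> v \<longleftrightarrow> (\<exists>u w. (v, u) \<in> parcs \<Gamma> \<and> (v, w) \<in> parcs \<Gamma> \<and> (u, w) \<in> parcs \<Gamma>)"

lemma automorphism_in_triangle:
  assumes wf: "pair_wf_digraph \<Gamma>" and \<phi>: "\<phi> \<in> graph_automorphisms \<Gamma>" and v: "v \<in> pverts \<Gamma>"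
  shows "in_triangle \<Gamma> (\<phi> v) \<longleftrightarrow> in_triangle \<Gamma> v"
proof -
  interpret pair_wf_digraph \<Gamma> by (rule wf)
  have arc: "(v, u) \<in> parcs \<Gamma> \<Longrightarrow> u \<in> pverts \<Gamma>" for u by (rule in_arcsD2)
  have "in_triangle \<Gamma> z \<longleftrightarrow> (\<exists>u \<in> parcs \<Gamma> `` {z}. \<exists>w \<in> parcs \<Gamma> `` {z}. (u, w) \<in> parcs \<Gamma>)" for z
    by (auto simp: in_triangle_def)
  then show ?thesis
    using automorphism_arc_iff[OF \<phi>] arc
    by (simp add: automorphism_neighbours[OF wf \<phi> v])
qed

text \<open>
  Invariants of nodes can be refined: summing an invariant over the neighbours yields a new one.
\<close>

lemma automorphism_sum_neighbours:
  assumes wf: "pair_wf_digraph \<Gamma>" and \<phi>: "\<phi> \<in> graph_automorphisms \<Gamma>" and v: "v \<in> pverts \<Gamma>"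
    and c: "\<And>u. u \<in> pverts \<Gamma> \<Longrightarrow> c (\<phi> u) = c u"
  shows "sum c (parcs \<Gamma> `` {\<phi> v}) = sum c (parcs \<Gamma> `` {v})"
proof -
  interpret pair_wf_digraph \<Gamma> by (rule wf)
  have sub: "parcs \<Gamma> `` {v} \<subseteq> pverts \<Gamma>" using in_arcsD2 by auto
  then have "inj_on \<phi> (parcs \<Gamma> `` {v})"
    using automorphism_bij[OF \<phi>] by (meson bij_betw_def inj_on_subset)
  then have "sum c (parcs \<Gamma> `` {\<phi> v}) = sum (c \<circ> \<phi>) (parcs \<Gamma> `` {v})"
    by (simp add: automorphism_neighbours[OF wf \<phi> v] sum.reindex)
  also have "\<dots> = sum c (parcs \<Gamma> `` {v})"
    using sub c by (intro sum.cong) auto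
  finally show ?thesis .
qed

lemma cubic_graph_iff:
  "cubic_graph \<Gamma> \<longleftrightarrow> finite (pverts \<Gamma>) \<and> pverts \<Gamma> \<noteq> {} \<and> parcs \<Gamma> \<subseteq> pverts \<Gamma> \<times> pverts \<Gamma>
     \<and> sym (parcs \<Gamma>) \<and> irrefl (parcs \<Gamma>) \<and> (\<forall>v \<in> pverts \<Gamma>. card (parcs \<Gamma> `` {v}) = 3)"
proof -
  have deg: "out_degree (with_proj \<Gamma>) v = card (parcs \<Gamma> `` {v})" for v
  proof -
    have "out_arcs (with_proj \<Gamma>) v = Pair v ` (parcs \<Gamma> `` {v})"
      by (auto simp: out_arcs_def)
    then show ?thesis
      by (simp add: out_degree_def card_image inj_on_def)
  qed
  have "pair_graph \<Gamma> \<longleftrightarrow> finite (pverts \<Gamma>) \<and> parcs \<Gamma> \<subseteq> pverts \<Gamma> \<times> pverts \<Gamma>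
     \<and> sym (parcs \<Gamma>) \<and> irrefl (parcs \<Gamma>)"
  proof
    assume "pair_graph \<Gamma>"
    then interpret pair_graph \<Gamma> .
    show "finite (pverts \<Gamma>) \<and> parcs \<Gamma> \<subseteq> pverts \<Gamma> \<times> pverts \<Gamma> \<and> sym (parcs \<Gamma>) \<and> irrefl (parcs \<Gamma>)"
      using pair_finite_verts in_arcsD1 in_arcsD2 pair_sym_arcs pair_no_loops
      by (fastforce simp: irrefl_def symmetric_def)
  next
    assume *: "finite (pverts \<Gamma>) \<and> parcs \<Gamma> \<subseteq> pverts \<Gamma> \<times> pverts \<Gamma> \<and> sym (parcs \<Gamma>) \<and> irrefl (parcs \<Gamma>)"
    then have "finite (parcs \<Gamma>)" by (meson finite_SigmaI finite_subset)
    with * show "pair_graph \<Gamma>"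
      by unfold_locales (auto simp: irrefl_def symmetric_def)
  qed
  then show ?thesis by (auto simp: cubic_graph_def deg)
qed

text \<open>
  Node names are immaterial, so that the constructions below may use nodes of any type.
\<close>

lemma nat_copy:
  fixes \<Gamma> :: "'v pair_pre_digraph"
  assumes cubic: "cubic_graph \<Gamma>"
  obtains \<Delta> :: "nat pair_pre_digraph"
  where "cubic_graph \<Delta>" "Aut_graph \<Delta> \<cong> Aut_graph \<Gamma>" "card (pverts \<Delta>) = card (pverts \<Gamma>)"
proof -
  let ?V = "pverts \<Gamma>" and ?E = "parcs \<Gamma>"
  have V: "finite ?V" "?V \<noteq> {}" "?E \<subseteq> ?V \<times> ?V" "sym ?E" "irrefl ?E"
    and deg: "\<And>v. v \<in> ?V \<Longrightarrow> card (?E `` {v}) = 3"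
    using cubic by (auto simp: cubic_graph_iff)
  obtain e :: "'v \<Rightarrow> nat" where e: "inj_on e ?V"
    using finite_imp_inj_to_nat_seg[OF V(1)] by blast
  define d where "d = inv_into ?V e"
  have de [simp]: "d (e v) = v" if "v \<in> ?V" for v
    using e that by (simp add: d_def)
  define \<Delta> where "\<Delta> = \<lparr>pverts = e ` ?V, parcs = map_prod e e ` ?E\<rparr>"
  have pv [simp]: "pverts \<Delta> = e ` ?V" and pa: "parcs \<Delta> = map_prod e e ` ?E"
    by (simp_all add: \<Delta>_def)
  have arc: "(e u, e v) \<in> parcs \<Delta> \<longleftrightarrow> (u, v) \<in> ?E" if "u \<in> ?V" "v \<in> ?V" for u v
  proof
    assume "(e u, e v) \<in> parcs \<Delta>"
    then obtain u' v' where *: "(u', v') \<in> ?E" "e u = e u'" "e v = e v'" by (auto simp: pa)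
    then have "u' \<in> ?V" "v' \<in> ?V" using V(3) by auto
    then have "u = u'" "v = v'" using * that e by (auto simp: inj_on_def)
    then show "(u, v) \<in> ?E" using * by simp
  qed (force simp: pa)
  have dV: "d w \<in> ?V" "e (d w) = w" if "w \<in> e ` ?V" for w
    using that by auto
  have "cubic_graph \<Delta>"
    unfolding cubic_graph_iff
  proof (intro conjI ballI)
    show "finite (pverts \<Delta>)" "pverts \<Delta> \<noteq> {}" using V by auto
    show "parcs \<Delta> \<subseteq> pverts \<Delta> \<times> pverts \<Delta>" using V(3) by (auto simp: pa)
    show "sym (parcs \<Delta>)" using V(4) by (force simp: pa sym_def)
    show "irrefl (parcs \<Delta>)"
      unfolding irrefl_def
    proof (intro allI notI)
      fix w assume "(w, w) \<in> parcs \<Delta>"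
      then obtain u v where uv: "(u, v) \<in> ?E" "e u = e v" by (auto simp: pa)
      then have "u = v" using e V(3) by (auto simp: inj_on_def)
      then show False using uv V(5) by (auto simp: irrefl_def)
    qed
    fix w assume "w \<in> pverts \<Delta>"
    then obtain v where v: "v \<in> ?V" "w = e v" by auto
    have "parcs \<Delta> `` {e v} = e ` (?E `` {v})"
    proof (intro equalityI subsetI)
      fix z assume "z \<in> parcs \<Delta> `` {e v}"
      then obtain u' v' where *: "(v', u') \<in> ?E" "e v = e v'" "z = e u'" by (auto simp: pa)
      moreover from * have "v = v'" using v e V(3) by (auto simp: inj_on_def)
      ultimately show "z \<in> e ` (?E `` {v})" by auto
    qed (use V(3) in \<open>force simp: pa\<close>)
    moreover have "inj_on e (?E `` {v})"
      using e V(3) by (auto simp: inj_on_def)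
    ultimately show "card (parcs \<Delta> `` {w}) = 3"
      using deg v by (simp add: card_image)
  qed
  moreover have "card (pverts \<Delta>) = card ?V" using e by (simp add: card_image)
  moreover have "Aut_graph \<Gamma> \<cong> Aut_graph \<Delta>"
  proof -
    define \<Psi> where "\<Psi> \<phi> = (\<lambda>w \<in> e ` ?V. e (\<phi> (d w)))" for \<phi>
    define \<Theta> where "\<Theta> \<psi> = (\<lambda>v \<in> ?V. d (\<psi> (e v)))" for \<psi>
    have be: "bij_betw e ?V (e ` ?V)" using e by (simp add: bij_betw_def)
    have bd: "bij_betw d (e ` ?V) ?V" unfolding d_def by (rule bij_betw_inv_into[OF be])
    have \<Psi>: "\<Psi> \<phi> \<in> graph_automorphisms \<Delta>" if \<phi>: "\<phi> \<in> graph_automorphisms \<Gamma>" for \<phi>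
    proof -
      note b = automorphism_bij[OF \<phi>]
      have "bij_betw (e \<circ> \<phi> \<circ> d) (e ` ?V) (e ` ?V)"
        using bd b be by (blast intro: bij_betw_trans)
      then have "bij_betw (\<Psi> \<phi>) (e ` ?V) (e ` ?V)"
        by (rule bij_betw_cong[THEN iffD1, rotated]) (simp add: \<Psi>_def)
      moreover have "\<phi> v \<in> ?V" if "v \<in> ?V" for v using b that by (auto simp: bij_betw_def)
      ultimately show ?thesis
        using arc automorphism_arc_iff[OF \<phi>]
        by (auto simp: graph_automorphisms_def Bij_def \<Psi>_def)
    qed
    have \<Theta>: "\<Theta> \<psi> \<in> graph_automorphisms \<Gamma>" if \<psi>: "\<psi> \<in> graph_automorphisms \<Delta>" for \<psi>
    proof -
      have b: "bij_betw \<psi> (e ` ?V) (e ` ?V)" using automorphism_bij[OF \<psi>] by simp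
      have "bij_betw (d \<circ> \<psi> \<circ> e) ?V ?V"
        using bd b be by (blast intro: bij_betw_trans)
      then have "bij_betw (\<Theta> \<psi>) ?V ?V"
        by (rule bij_betw_cong[THEN iffD1, rotated]) (simp add: \<Theta>_def)
      moreover have "(u, v) \<in> ?E \<longleftrightarrow> (d (\<psi> (e u)), d (\<psi> (e v))) \<in> ?E" if "u \<in> ?V" "v \<in> ?V" for u v
      proof -
        have *: "\<psi> (e u) \<in> e ` ?V" "\<psi> (e v) \<in> e ` ?V" using b that by (auto simp: bij_betw_def)
        have "(u, v) \<in> ?E \<longleftrightarrow> (\<psi> (e u), \<psi> (e v)) \<in> parcs \<Delta>"
          using arc[OF that] automorphism_arc_iff[OF \<psi>] that by simp
        then show ?thesis using arc[OF dV(1)[OF *(1)] dV(1)[OF *(2)]] dV(2)[OF *(1)] dV(2)[OF *(2)]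
          by simp
      qed
      ultimately show ?thesis
        by (auto simp: graph_automorphisms_def Bij_def \<Theta>_def)
    qed
    have "bij_betw \<Psi> (graph_automorphisms \<Gamma>) (graph_automorphisms \<Delta>)"
    proof (rule bij_betw_byWitness[where f' = \<Theta>])
      show "\<forall>\<phi> \<in> graph_automorphisms \<Gamma>. \<Theta> (\<Psi> \<phi>) = \<phi>"
      proof
        fix \<phi> assume \<phi>: "\<phi> \<in> graph_automorphisms \<Gamma>"
        then have "\<phi> v \<in> ?V" if "v \<in> ?V" for v
          using automorphism_bij[OF \<phi>] that by (auto simp: bij_betw_def)
        moreover have "\<phi> \<in> extensional ?V" using \<phi> by (simp add: graph_automorphisms_def Bij_def)
        ultimately show "\<Theta> (\<Psi> \<phi>) = \<phi>"
          by (intro extensionalityI[of _ ?V]) (auto simp: \<Theta>_def \<Psi>_def)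
      qed
      show "\<forall>\<psi> \<in> graph_automorphisms \<Delta>. \<Psi> (\<Theta> \<psi>) = \<psi>"
      proof
        fix \<psi> assume \<psi>: "\<psi> \<in> graph_automorphisms \<Delta>"
        then have "\<psi> w \<in> e ` ?V" if "w \<in> e ` ?V" for w
          using automorphism_bij[OF \<psi>] that by (auto simp: bij_betw_def)
        moreover have "\<psi> \<in> extensional (e ` ?V)" using \<psi> by (simp add: graph_automorphisms_def Bij_def)
        ultimately show "\<Psi> (\<Theta> \<psi>) = \<psi>"
          using dV by (intro extensionalityI[of _ "e ` ?V"]) (auto simp: \<Theta>_def \<Psi>_def)
      qed
    qed (use \<Psi> \<Theta> in auto)
    moreover have "\<Psi> (compose ?V \<phi> \<phi>') = compose (e ` ?V) (\<Psi> \<phi>) (\<Psi> \<phi>')"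
      if \<phi>: "\<phi> \<in> graph_automorphisms \<Gamma>" "\<phi>' \<in> graph_automorphisms \<Gamma>" for \<phi> \<phi>'
    proof -
      have "\<phi>' v \<in> ?V" if "v \<in> ?V" for v
        using automorphism_bij[OF \<phi>(2)] that by (auto simp: bij_betw_def)
      then show ?thesis
        by (intro extensionalityI[of _ "e ` ?V"]) (auto simp: \<Psi>_def compose_def)
    qed
    moreover have "graph_automorphisms \<Gamma> \<subseteq> Bij ?V" "graph_automorphisms \<Delta> \<subseteq> Bij (e ` ?V)"
      by (auto simp: graph_automorphisms_def)
    ultimately have "\<Psi> \<in> iso (Aut_graph \<Gamma>) (Aut_graph \<Delta>)"
      using \<Psi> by (auto simp: iso_def hom_def Aut_graph_def BijGroup_def subset_eq)
    then show ?thesis by (auto simp: is_iso_def)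
  qed
  then have "Aut_graph \<Delta> \<cong> Aut_graph \<Gamma>" by (rule group.iso_sym[OF group_Aut_graph])
  ultimately show ?thesis using that by blast
qed

section \<open>Derived graphs of voltage graphs\<close>

text \<open>
  The set \<open>nb k\<close> consists of the darts that leave the site \<open>k\<close>, each given by its end
  and its voltage. Parallel darts with different voltages and loops with a voltage other than
  \<open>\<one>\<close> are admitted, since they still give a simple derived graph; a loop whose voltage is an
  involution is a single dart, its own reverse.
\<close>

locale voltage_graph = group G for G (structure) +
  fixes K :: "'k set" and nb :: "'k \<Rightarrow> ('k \<times> 'a) set"
  assumes finite_carrier: "finite (carrier G)"
    and finite_sites: "finite K" and sites_nonempty: "K \<noteq> {}"
    and dart_closed: "\<lbrakk>k \<in> K; (l, v) \<in> nb k\<rbrakk> \<Longrightarrow> l \<in> K \<and> v \<in> carrier G"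
    and dart_sym: "\<lbrakk>k \<in> K; (l, v) \<in> nb k\<rbrakk> \<Longrightarrow> (k, inv v) \<in> nb l"
    and dart_card: "k \<in> K \<Longrightarrow> card (nb k) = 3"
    and no_trivial_loop: "k \<in> K \<Longrightarrow> (k, \<one>) \<notin> nb k"
begin

definition derived :: "('k \<times> 'a) pair_pre_digraph" where
  "derived = \<lparr>pverts = K \<times> carrier G,
     parcs = {((k, x), (l, x \<otimes> v)) |k x l v. k \<in> K \<and> x \<in> carrier G \<and> (l, v) \<in> nb k}\<rparr>"

lemma pverts_derived [simp]: "pverts derived = K \<times> carrier G"
  by (simp add: derived_def)

lemma arc_derived_iff:
  "((k, x), (l, y)) \<in> parcs derived \<longleftrightarrow>
     k \<in> K \<and> x \<in> carrier G \<and> (\<exists>v. (l, v) \<in> nb k \<and> y = x \<otimes> v)"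
  by (auto simp: derived_def)

lemma neighbours_derived:
  assumes "k \<in> K" "x \<in> carrier G"
  shows "parcs derived `` {(k, x)} = (\<lambda>(l, v). (l, x \<otimes> v)) ` nb k"
  using assms by (auto simp: arc_derived_iff)

lemma inj_on_neighbours:
  assumes "k \<in> K" "x \<in> carrier G"
  shows "inj_on (\<lambda>(l, v). (l, x \<otimes> v)) (nb k)"
  using assms dart_closed[OF assms(1)] by (auto simp: inj_on_def)

lemma card_derived: "card (pverts derived) = card K * order G"
  by (simp add: order_def card_cartesian_product)

lemma cubic_derived: "cubic_graph derived"
  unfolding cubic_graph_iff
proof (intro conjI ballI)
  show "finite (pverts derived)" using finite_sites finite_carrier by simp
  show "pverts derived \<noteq> {}" using sites_nonempty one_closed by (auto simp del: one_closed)
  show "parcs derived \<subseteq> pverts derived \<times> pverts derived"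
    using dart_closed by (auto simp: derived_def)
  show "sym (parcs derived)"
  proof (rule symI, clarify)
    fix k x l y assume "((k, x), (l, y)) \<in> parcs derived"
    then obtain v where *: "k \<in> K" "x \<in> carrier G" "(l, v) \<in> nb k" "y = x \<otimes> v"
      by (auto simp: arc_derived_iff)
    with dart_closed[of k l v] have "l \<in> K" "v \<in> carrier G" by auto
    moreover from this * have "x = y \<otimes> inv v" by (simp add: m_assoc)
    ultimately show "((l, y), (k, x)) \<in> parcs derived"
      using dart_sym * by (auto simp: arc_derived_iff)
  qed
  show "irrefl (parcs derived)"
    unfolding irrefl_def
  proof (intro allI notI, clarify)
    fix k x assume "((k, x), (k, x)) \<in> parcs derived"
    then obtain v where *: "k \<in> K" "x \<in> carrier G" "(k, v) \<in> nb k" "x = x \<otimes> v"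
      by (auto simp: arc_derived_iff)
    then have "v = \<one>" using dart_closed[of k k v] l_cancel_one'[of x v] by simp
    then show False using * no_trivial_loop by auto
  qed
  fix w assume "w \<in> pverts derived"
  then obtain k x where w: "w = (k, x)" "k \<in> K" "x \<in> carrier G" by auto
  then show "card (parcs derived `` {w}) = 3"
    by (simp add: neighbours_derived card_image inj_on_neighbours dart_card)
qed

lemma wf_derived: "pair_wf_digraph derived"
  using cubic_derived by unfold_locales (auto simp: cubic_graph_iff)

text \<open>
  Triangles of the derived graph are closed walks of length three in the base with total voltage
  \<open>\<one>\<close>.
\<close>

lemma in_triangle_derived:
  assumes k: "k \<in> K" and x: "x \<in> carrier G"
  shows "in_triangle derived (k, x) \<longleftrightarrow>
    (\<exists>(l, v) \<in> nb k. \<exists>(l', v') \<in> nb k. (l', inv v \<otimes> v') \<in> nb l)"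
proof
  assume "in_triangle derived (k, x)"
  then obtain l y l' z where "((k, x), (l, y)) \<in> parcs derived"
    "((k, x), (l', z)) \<in> parcs derived" "((l, y), (l', z)) \<in> parcs derived"
    unfolding in_triangle_def by (metis prod.exhaust)
  then obtain v v' w where *: "(l, v) \<in> nb k" "(l', v') \<in> nb k" "(l', w) \<in> nb l"
    and eq: "x \<otimes> v' = x \<otimes> v \<otimes> w"
    by (auto simp: arc_derived_iff)
  have "l \<in> K" using dart_closed[OF k *(1)] by simp
  then have "v \<in> carrier G" "v' \<in> carrier G" "w \<in> carrier G"
    using dart_closed * k by blast+
  then have "w = inv v \<otimes> v'" using eq x by (simp add: m_assoc inv_solve_left)
  with * show "\<exists>(l, v) \<in> nb k. \<exists>(l', v') \<in> nb k. (l', inv v \<otimes> v') \<in> nb l" by blast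
next
  assume "\<exists>(l, v) \<in> nb k. \<exists>(l', v') \<in> nb k. (l', inv v \<otimes> v') \<in> nb l"
  then obtain l v l' v' where *: "(l, v) \<in> nb k" "(l', v') \<in> nb k" "(l', inv v \<otimes> v') \<in> nb l"
    by blast
  then have "l \<in> K" "v \<in> carrier G" "v' \<in> carrier G" using dart_closed k by blast+
  moreover from this have "x \<otimes> v' = x \<otimes> v \<otimes> (inv v \<otimes> v')"
    using x by (simp add: m_assoc inv_solve_left'[symmetric]) (simp add: m_assoc[symmetric])
  ultimately have "((k, x), (l, x \<otimes> v)) \<in> parcs derived" "((k, x), (l', x \<otimes> v')) \<in> parcs derived"
    "((l, x \<otimes> v), (l', x \<otimes> v')) \<in> parcs derived"
    using * k x unfolding arc_derived_iff by auto
  then show "in_triangle derived (k, x)" unfolding in_triangle_def by blast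
qed

text \<open>
  An automorphism \<open>(k, x) \<mapsto> (k, f x)\<close> maps the neighbour \<open>(l, x v)\<close> of \<open>(k, x)\<close> to
  a neighbour of \<open>(k, f x)\<close> over \<open>l\<close>. If the darts from \<open>k\<close> to \<open>l\<close> have at most one
  voltage besides \<open>\<one>\<close>, injectivity leaves no choice but \<open>f (x v) = f x v\<close>.
\<close>

lemma Aut_derived:
  assumes rigid: "\<And>\<phi>. \<phi> \<in> graph_automorphisms derived \<Longrightarrow>
      \<exists>f. \<forall>k \<in> K. \<forall>x \<in> carrier G. \<phi> (k, x) = (k, f x)"
    and parallel: "\<And>k l v w. \<lbrakk>k \<in> K; (l, v) \<in> nb k; (l, w) \<in> nb k\<rbrakk> \<Longrightarrow> v = w \<or> v = \<one> \<or> w = \<one>"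
    and gen: "generate G (\<Union>k \<in> K. snd ` nb k) = carrier G"
  shows "Aut_graph derived \<cong> G"
proof -
  let ?V = "K \<times> carrier G"
  define \<rho> where "\<rho> y = (\<lambda>(k, x) \<in> ?V. (k, y \<otimes> x))" for y
  have \<rho> [simp]: "\<rho> y (k, x) = (k, y \<otimes> x)" if "k \<in> K" "x \<in> carrier G" for y k x
    using that by (simp add: \<rho>_def)
  have ext: "\<rho> y \<in> extensional ?V" for y by (simp add: \<rho>_def)
  obtain k0 where k0: "k0 \<in> K" using sites_nonempty by auto
  have \<rho>_Aut: "\<rho> y \<in> graph_automorphisms derived" if y: "y \<in> carrier G" for y
  proof -
    have "bij_betw (\<rho> y) ?V ?V"
      by (rule bij_betw_byWitness[where f' = "\<lambda>(k, x). (k, inv y \<otimes> x)"])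
         (use y in \<open>auto simp: m_assoc[symmetric]\<close>)
    moreover have "((k, x), (l, z)) \<in> parcs derived \<longleftrightarrow> ((k, y \<otimes> x), (l, y \<otimes> z)) \<in> parcs derived"
      if "k \<in> K" "x \<in> carrier G" "l \<in> K" "z \<in> carrier G" for k x l z
      using that y dart_closed by (auto simp: arc_derived_iff m_assoc) 
    ultimately show ?thesis
      using ext by (auto simp: graph_automorphisms_def Bij_def)
  qed
  have "\<rho> ` carrier G = graph_automorphisms derived"
  proof (intro equalityI subsetI)
    fix \<phi> assume \<phi>: "\<phi> \<in> graph_automorphisms derived"
    then obtain f where f: "\<And>k x. \<lbrakk>k \<in> K; x \<in> carrier G\<rbrakk> \<Longrightarrow> \<phi> (k, x) = (k, f x)"
      using rigid by blast
    note bij = automorphism_bij[OF \<phi>, unfolded pverts_derived]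
    have fG: "f x \<in> carrier G" if "x \<in> carrier G" for x
      using bij_betw_apply[OF bij, of "(k0, x)"] f[OF k0 that] k0 that by simp
    have f_inj: "x = y" if "f x = f y" "x \<in> carrier G" "y \<in> carrier G" for x y
      using inj_onD[OF bij_betw_imp_inj_on[OF bij], of "(k0, x)" "(k0, y)"] f k0 that by simp
    have f_dart: "f (x \<otimes> v) = f x \<otimes> v"
      if k: "k \<in> K" and v: "(l, v) \<in> nb k" and x: "x \<in> carrier G" for k l v x
    proof -
      have l: "l \<in> K" "v \<in> carrier G" using dart_closed k v by auto
      have "((k, x), (l, x \<otimes> v)) \<in> parcs derived" using k v x by (auto simp: arc_derived_iff)
      then have "((k, f x), (l, f (x \<otimes> v))) \<in> parcs derived"
        using automorphism_arc_iff[OF \<phi>, of "(k, x)" "(l, x \<otimes> v)"] k l x by (simp add: f)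
      then obtain w where w: "(l, w) \<in> nb k" "f (x \<otimes> v) = f x \<otimes> w"
        by (auto simp: arc_derived_iff)
      from parallel[OF k v w(1)] show ?thesis
      proof (elim disjE)
        assume "w = \<one>"
        then have "x \<otimes> v = x" using w l x fG f_inj[of "x \<otimes> v" x] by simp
        then have "v = \<one>" using x l by simp
        then show ?thesis using x fG by simp
      qed (use w x fG in auto)
    qed
    have f_gen: "h \<in> generate G (\<Union>k \<in> K. snd ` nb k) \<Longrightarrow>
      \<forall>x \<in> carrier G. f (x \<otimes> h) = f x \<otimes> h" for h
    proof (induction rule: generate.induct)
      case one
      then show ?case using fG by simp
    next
      case (incl h)
      then show ?case using f_dart by auto
    next
      case (inv h)
      then obtain k l where k: "k \<in> K" "(l, h) \<in> nb k" by auto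
      then have "l \<in> K" "(k, inv h) \<in> nb l" using dart_closed dart_sym by blast+
      then show ?case using f_dart by blast
    next
      case (eng h1 h2)
      then have "h1 \<in> carrier G" "h2 \<in> carrier G" using gen by auto
      then show ?case using eng fG by (simp add: m_assoc[symmetric])
    qed
    have f_left: "f x = f \<one> \<otimes> x" if "x \<in> carrier G" for x
      using bspec[OF f_gen[of x] one_closed] that gen by simp
    have "\<phi> = \<rho> (f \<one>)"
    proof (rule extensionalityI[of _ ?V])
      show "\<phi> \<in> extensional ?V" using \<phi> by (simp add: graph_automorphisms_def Bij_def)
      fix z assume "z \<in> ?V"
      then obtain k x where z: "z = (k, x)" "k \<in> K" "x \<in> carrier G" by auto
      then have "\<phi> z = (k, f x)" by (simp add: f)
      also have "\<dots> = \<rho> (f \<one>) z" using z f_left[of x] by simp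
      finally show "\<phi> z = \<rho> (f \<one>) z" .
    qed (rule ext)
    then show "\<phi> \<in> \<rho> ` carrier G" using fG by auto
  qed (use \<rho>_Aut in auto)
  moreover have "inj_on \<rho> (carrier G)"
  proof (rule inj_onI)
    fix y z assume yz: "y \<in> carrier G" "z \<in> carrier G" and "\<rho> y = \<rho> z"
    then have "\<rho> y (k0, \<one>) = \<rho> z (k0, \<one>)" by simp
    then show "y = z" using k0 yz by simp
  qed
  moreover have "\<rho> (y \<otimes> z) = compose ?V (\<rho> y) (\<rho> z)"
    if "y \<in> carrier G" "z \<in> carrier G" for y z
    using that ext by (intro extensionalityI[of _ ?V]) (auto simp: compose_def m_assoc)
  moreover have "graph_automorphisms derived \<subseteq> Bij ?V"
    by (auto simp: graph_automorphisms_def)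
  ultimately have "\<rho> \<in> iso G (Aut_graph derived)"
    using \<rho>_Aut by (auto simp: iso_def hom_def bij_betw_def Aut_graph_def BijGroup_def subset_eq)
  then have "G \<cong> Aut_graph derived" by (auto simp: is_iso_def)
  then show ?thesis by (rule iso_sym)
qed

text \<open>
  If the triangles of the derived graph lie over the sites \<open>T\<close>, then a node over \<open>k\<close>
  starts \<open>walks T r k\<close> walks of length \<open>r\<close> that end in a triangle. The number depends only on the
  site, but is an invariant of the node in the derived graph, and so helps to recognise the site.
\<close>

primrec walks :: "'k set \<Rightarrow> nat \<Rightarrow> 'k \<Rightarrow> nat" where
  "walks T 0 k = (if k \<in> T then 1 else 0)"
| "walks T (Suc r) k = (\<Sum>(l, v) \<in> nb k. walks T r l)"

lemma automorphism_walks: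
  assumes \<phi>: "\<phi> \<in> graph_automorphisms derived"
    and T: "\<And>k x. \<lbrakk>k \<in> K; x \<in> carrier G\<rbrakk> \<Longrightarrow> in_triangle derived (k, x) \<longleftrightarrow> k \<in> T"
    and z: "z \<in> K \<times> carrier G"
  shows "walks T r (fst (\<phi> z)) = walks T r (fst z)"
  using z
proof (induction r arbitrary: z)
  case 0
  then obtain k x l y where z: "z = (k, x)" "\<phi> z = (l, y)" by (meson prod.exhaust)
  then have "(l, y) \<in> K \<times> carrier G"
    using 0 bij_betw_apply[OF automorphism_bij[OF \<phi>], of z] by simp
  with z 0 show ?case
    using automorphism_in_triangle[OF wf_derived \<phi>, of z] T by simp
next
  case (Suc r)
  have step: "(\<Sum>w \<in> parcs derived `` {z}. walks T r (fst w)) = walks T (Suc r) (fst z)"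
    if "z \<in> K \<times> carrier G" for z
  proof -
    from that obtain k x where z: "z = (k, x)" "k \<in> K" "x \<in> carrier G" by auto
    then show ?thesis
      by (simp add: neighbours_derived sum.reindex inj_on_neighbours) (simp add: case_prod_unfold o_def)
  qed
  have "\<phi> z \<in> K \<times> carrier G"
    using Suc.prems bij_betw_apply[OF automorphism_bij[OF \<phi>], of z] by simp
  then show ?case
    using automorphism_sum_neighbours[OF wf_derived \<phi>, of z "\<lambda>w. walks T r (fst w)"] Suc step
    by simp
qed

end

section \<open>A ladder closed by a triangle\<close>

datatype site = T1 | T3 | Q nat | R nat

definition ladder_sites :: "nat \<Rightarrow> site set" where
  "ladder_sites m = {T1, T3} \<union> Q ` {..m} \<union> R ` {..m}"

lemma mem_ladder_sites [simp]:
  "T1 \<in> ladder_sites m" "T3 \<in> ladder_sites m" "Q j \<in> ladder_sites m \<longleftrightarrow> j \<le> m" "R j \<in> ladder_sites m \<longleftrightarrow> j \<le> m"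
  by (auto simp: ladder_sites_def)

lemma card_ladder_sites: "card (ladder_sites m) = 2 * m + 4"
proof -
  have "card (Q ` {..m} \<union> R ` {..m}) = 2 * m + 2"
    by (subst card_Un_disjoint) (auto simp: card_image inj_on_def)
  then have "card ({T1, T3} \<union> (Q ` {..m} \<union> R ` {..m})) = 2 * m + 4"
    by (subst card_Un_disjoint) auto
  then show ?thesis by (simp add: ladder_sites_def Un_assoc)
qed

lemma ladder_site_cases [consumes 1, case_names T1 T3 Q0 R0 Q R]:
  assumes "k \<in> ladder_sites m"
  obtains "k = T1" | "k = T3" | "k = Q 0" | "k = R 0"
    | j where "k = Q (Suc j)" "Suc j \<le> m" | j where "k = R (Suc j)" "Suc j \<le> m"
proof (cases k)
  case (Q j)
  with assms that show ?thesis by (cases j) auto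
next
  case (R j)
  with assms that show ?thesis by (cases j) auto
qed (use that in auto)

text \<open>
  Since \<open>a\<close> and \<open>c m\<close> are not \<open>\<one>\<close>, neither the three sites \<open>T1, T3, R 0\<close> give
  a triangle of the derived graph nor the two darts from \<open>Q m\<close> to \<open>R m\<close> a double edge. The
  assumption \<open>link\<close> makes automorphisms act in the same way on both rails.
\<close>

locale ladder = group G for G (structure) +
  fixes m :: nat and a :: 'a and c :: "nat \<Rightarrow> 'a"
  assumes fin: "finite (carrier G)"
    and m: "1 \<le> m"
    and a: "a \<in> carrier G" "a \<noteq> \<one>"
    and c: "c j \<in> carrier G" "c m \<noteq> \<one>"
    and link: "m = 1 \<and> c 1 \<noteq> a \<or> 2 \<le> m \<and> c 1 = \<one>"
    and gen: "generate G (insert a (c ` {1..m})) = carrier G"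
begin

abbreviation sites :: "site set" where
  "sites \<equiv> ladder_sites m"

text \<open>
  This is a predicate rather than the equation \<open>j = m\<close> because simplification would use the
  equation to eliminate \<open>m\<close>, on which the base graph depends.
\<close>

definition top_level :: "nat \<Rightarrow> bool" where
  "top_level j \<longleftrightarrow> m \<le> j"

lemma not_top_level [simp]: "j < m \<Longrightarrow> \<not> top_level j" "Suc j \<le> m \<Longrightarrow> \<not> top_level j"
    "\<not> top_level j \<Longrightarrow> Suc j \<le> m"
  by (auto simp: top_level_def)

fun darts :: "site \<Rightarrow> (site \<times> 'a) set" where
  "darts T1 = {(Q 0, \<one>), (T3, \<one>), (R 0, \<one>)}"
| "darts T3 = {(Q 0, \<one>), (T1, \<one>), (R 0, a)}"
| "darts (Q 0) = {(T1, \<one>), (T3, \<one>), (Q 1, \<one>)}"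
| "darts (R 0) = {(T1, \<one>), (T3, inv a), (R 1, \<one>)}"
| "darts (Q (Suc j)) =
     {(Q j, \<one>), (if top_level (Suc j) then R (Suc j) else Q (Suc (Suc j)), \<one>), (R (Suc j), c (Suc j))}"
| "darts (R (Suc j)) =
     {(R j, \<one>), (if top_level (Suc j) then Q (Suc j) else R (Suc (Suc j)), \<one>), (Q (Suc j), inv (c (Suc j)))}"

lemma inv_ne_one: "v \<in> carrier G \<Longrightarrow> v \<noteq> \<one> \<Longrightarrow> inv v \<noteq> \<one>"
  by (metis inv_inv inv_one)

lemma not_one [simp]: "a \<noteq> \<one>" "\<one> \<noteq> a" "inv a \<noteq> \<one>" "\<one> \<noteq> inv a"
    "c m \<noteq> \<one>" "\<one> \<noteq> c m" "inv (c m) \<noteq> \<one>" "\<one> \<noteq> inv (c m)"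
    "a \<in> carrier G" "c j \<in> carrier G"
  using a c inv_ne_one[of a] inv_ne_one[of "c m"]
    inv_ne_one[of a, symmetric] inv_ne_one[of "c m", symmetric] by auto

lemma c_last [simp]:
  assumes "Suc j \<le> m" "top_level (Suc j)"
  shows "c (Suc j) \<noteq> \<one>" "\<one> \<noteq> c (Suc j)" "inv (c (Suc j)) \<noteq> \<one>" "\<one> \<noteq> inv (c (Suc j))"
proof -
  have "Suc j = m" using assms by (simp add: top_level_def)
  then show "c (Suc j) \<noteq> \<one>" "\<one> \<noteq> c (Suc j)" "inv (c (Suc j)) \<noteq> \<one>" "\<one> \<noteq> inv (c (Suc j))"
    using not_one by auto
qed

sublocale voltage_graph G sites darts
proof
  show "finite sites" "sites \<noteq> {}" by (auto simp: ladder_sites_def)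
  show "finite (carrier G)" by (rule fin)
  fix k assume k: "k \<in> sites"
  show "l \<in> sites \<and> v \<in> carrier G" if "(l, v) \<in> darts k" for l v
    using k that m by (cases k rule: ladder_site_cases) (auto split: if_splits)
  show "(k, inv v) \<in> darts l" if "(l, v) \<in> darts k" for l v
    using k
  proof (cases rule: ladder_site_cases)
    case (Q j)
    with that show ?thesis by (cases j) (auto split: if_splits)
  next
    case (R j)
    with that show ?thesis by (cases j) (auto split: if_splits)
  qed (use that m in auto)
  show "card (darts k) = 3"
    using k by (cases k rule: ladder_site_cases) auto
  show "(k, \<one>) \<notin> darts k"
    using k by (cases k rule: ladder_site_cases) auto
qed

text \<open>
  Apart from \<open>T1, Q 0, T3\<close>, only \<open>T1, T3, R 0\<close> are pairwise adjacent sites, and their total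
  voltage is not \<open>\<one>\<close>. Rungs do not occur in triangles of the base, so that no relation between
  their voltages can produce another triangle.
\<close>

lemma in_triangle_ladder:
  assumes k: "k \<in> sites" and x: "x \<in> carrier G"
  shows "in_triangle derived (k, x) \<longleftrightarrow> k \<in> {T1, T3, Q 0}"
proof -
  have "(\<exists>(l, v) \<in> darts k. \<exists>(l', v') \<in> darts k. (l', inv v \<otimes> v') \<in> darts l)
      \<longleftrightarrow> k \<in> {T1, T3, Q 0}"
    using k
  proof (cases rule: ladder_site_cases)
    case (Q j)
    then show ?thesis by (cases j) auto
  next
    case (R j)
    then show ?thesis by (cases j) auto
  qed auto
  then show ?thesis using in_triangle_derived[OF assms] by simp
qed

abbreviation tri_walks :: "nat \<Rightarrow> site \<Rightarrow> nat" where
  "tri_walks \<equiv> walks {T1, T3, Q 0}"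

text \<open>
  Outside of triangles, the value \<open>2\<close> singles out \<open>R 0\<close>; in a triangle, the next lemma
  singles out \<open>Q 0\<close>.
\<close>

lemma walks_one:
  assumes "k \<in> sites"
  shows "tri_walks 1 k = (if k \<in> {T1, T3, Q 0, R 0} then 2 else if k = Q 1 then 1 else 0)"
  using assms by (cases k rule: ladder_site_cases) auto

lemma walks_two: "tri_walks 2 T1 = 6" "tri_walks 2 T3 = 6" "tri_walks 2 (Q 0) = 5"
  using m by (simp_all add: numeral_2_eq_2)

text \<open>
  Rails and rungs look alike locally. They are told apart by climbing: if the action on the levels
  up to \<open>j\<close> is known, then the image of the rung at a node of level \<open>j\<close> is known too, and
  only the rail is left for its neighbour on level \<open>j + 1\<close>.
\<close>

lemma ladder_rigid:
  assumes \<phi>: "\<phi> \<in> graph_automorphisms derived"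
  shows "\<exists>f. \<forall>k \<in> sites. \<forall>x \<in> carrier G. \<phi> (k, x) = (k, f x)"
proof -
  note bij = automorphism_bij[OF \<phi>, unfolded pverts_derived]
  have closed: "fst (\<phi> (k, x)) \<in> sites" "snd (\<phi> (k, x)) \<in> carrier G"
    if "k \<in> sites" "x \<in> carrier G" for k x
    using bij_betw_apply[OF bij, of "(k, x)"] that by (auto simp: mem_Times_iff)
  have inj: "k = l \<and> x = y"
    if "\<phi> (k, x) = \<phi> (l, y)" "k \<in> sites" "x \<in> carrier G" "l \<in> sites" "y \<in> carrier G" for k l x y
    using inj_onD[OF bij_betw_imp_inj_on[OF bij] that(1)] that by simp
  have arc: "(\<phi> (k, x), \<phi> (l, x \<otimes> v)) \<in> parcs derived"
    if "k \<in> sites" "x \<in> carrier G" "(l, v) \<in> darts k" for k l x v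
    using automorphism_arc_iff[OF \<phi>, of "(k, x)" "(l, x \<otimes> v)"] that dart_closed[of k l v]
    by (auto simp: arc_derived_iff)
  have arc1: "(\<phi> (k, x), \<phi> (l, x)) \<in> parcs derived"
    if "k \<in> sites" "x \<in> carrier G" "(l, \<one>) \<in> darts k" for k l x
    using arc[OF that] that by simp
  have same_walks: "tri_walks r (fst (\<phi> (k, x))) = tri_walks r k" if "k \<in> sites" "x \<in> carrier G" for r k x
    using automorphism_walks[OF \<phi> in_triangle_ladder, of "(k, x)" r] that by simp
  have triangle: "fst (\<phi> (k, x)) \<in> {T1, T3, Q 0} \<longleftrightarrow> k \<in> {T1, T3, Q 0}"
    if "k \<in> sites" "x \<in> carrier G" for k x
    using same_walks[OF that, of 0] by (auto split: if_splits)
  define f where "f x = snd (\<phi> (Q 0, x))" for x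
  define h where "h x = snd (\<phi> (R 0, x))" for x
  have fG: "f x \<in> carrier G" "h x \<in> carrier G" if "x \<in> carrier G" for x
    using closed that by (simp_all add: f_def h_def)
  have Q0: "\<phi> (Q 0, x) = (Q 0, f x)" if x: "x \<in> carrier G" for x
  proof -
    have "fst (\<phi> (Q 0, x)) = Q 0"
      using triangle[of "Q 0" x] same_walks[of "Q 0" x 2] x walks_two by auto
    then show ?thesis by (simp add: f_def prod_eq_iff)
  qed
  have R0: "\<phi> (R 0, x) = (R 0, h x)" if x: "x \<in> carrier G" for x
  proof -
    have "tri_walks 1 (fst (\<phi> (R 0, x))) = tri_walks 1 (R 0)" by (rule same_walks) (use x in auto)
    then have "fst (\<phi> (R 0, x)) \<in> {T1, T3, Q 0, R 0}"
      using closed[of "R 0" x] x by (subst (asm) (1 2) walks_one) (auto split: if_splits)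
    then have "fst (\<phi> (R 0, x)) = R 0"
      using triangle[of "R 0" x] x by auto
    then show ?thesis by (simp add: h_def prod_eq_iff)
  qed
  have T: "\<phi> (k, x) = (T1, f x) \<or> \<phi> (k, x) = (T3, f x)"
    if k: "k \<in> {T1, T3}" and x: "x \<in> carrier G" for k x
  proof -
    have "fst (\<phi> (k, x)) \<noteq> Q 0"
      using k same_walks[of k x 2] x walks_two by auto
    moreover have "((Q 0, f x), \<phi> (k, x)) \<in> parcs derived"
      using arc1[of "Q 0" x k] k x Q0 by auto
    moreover have "fst (\<phi> (k, x)) \<in> {T1, T3, Q 0}" using triangle[of k x] k x by auto
    ultimately show ?thesis
      using fG[OF x] by (cases "\<phi> (k, x)") (auto simp: arc_derived_iff)
  qed
  \<comment> \<open>The rails are followed upwards; nothing relates f and h yet.\<close>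
  have level: "\<forall>i \<le> j. \<forall>x \<in> carrier G. \<phi> (Q i, x) = (Q i, f x) \<and> \<phi> (R i, x) = (R i, h x)"
    if "j \<le> m" for j
    using that
  proof (induction j)
    case 0
    then show ?case using Q0 R0 by simp
  next
    case (Suc j)
    have IH: "\<phi> (Q i, x) = (Q i, f x)" "\<phi> (R i, x) = (R i, h x)"
      if "i \<le> j" "x \<in> carrier G" for i x
      using Suc that by auto
    have "\<phi> (Q (Suc j), x) = (Q (Suc j), f x) \<and> \<phi> (R (Suc j), x) = (R (Suc j), h x)"
      if x: "x \<in> carrier G" for x
    proof (cases j)
      case 0
      have "((Q 0, f x), \<phi> (Q 1, x)) \<in> parcs derived" "((R 0, h x), \<phi> (R 1, x)) \<in> parcs derived"
        using arc1[of "Q 0" x "Q 1"] arc1[of "R 0" x "R 1"] x Q0 R0 by auto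
      moreover have "fst (\<phi> (Q 1, x)) \<notin> {T1, T3, Q 0}" "fst (\<phi> (R 1, x)) \<notin> {T1, T3, Q 0}"
        using triangle[of "Q 1" x] triangle[of "R 1" x] x m by auto
      ultimately show ?thesis
        using fG[OF x] 0 by (cases "\<phi> (Q 1, x)"; cases "\<phi> (R 1, x)") (auto simp: arc_derived_iff)
    next
      case (Suc i)
      have j: "j < m" "j \<noteq> m" using Suc.prems by auto
      have cj: "c j \<in> carrier G" by simp
      \<comment> \<open>The three neighbours of (Q j, f x) lie over Q i, R j and Q (Suc j);
         the first two are images of other nodes.\<close>
      have "((Q j, f x), \<phi> (Q (Suc j), x)) \<in> parcs derived"
        using arc1[of "Q j" x "Q (Suc j)"] x j IH Suc by auto
      moreover have "((Q j, f x), (R j, h (x \<otimes> c j))) \<in> parcs derived"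
        using arc[of "Q j" x "R j" "c j"] x j IH Suc by auto
      then have "h (x \<otimes> c j) = f x \<otimes> c j"
        using Suc j by (auto simp: arc_derived_iff)
      then have "\<phi> (Q (Suc j), x) \<noteq> (R j, f x \<otimes> c j)"
        using inj[of "Q (Suc j)" x "R j" "x \<otimes> c j"] IH(2)[of j "x \<otimes> c j"] x j by auto
      moreover have "\<phi> (Q (Suc j), x) \<noteq> (Q i, f x)"
        using inj[of "Q (Suc j)" x "Q i" x] IH(1)[of i x] x j Suc by auto
      ultimately have A: "\<phi> (Q (Suc j), x) = (Q (Suc j), f x)"
        using fG[OF x] Suc j by (cases "\<phi> (Q (Suc j), x)") (auto simp: arc_derived_iff)
      have "((R j, h x), \<phi> (R (Suc j), x)) \<in> parcs derived"
        using arc1[of "R j" x "R (Suc j)"] x j IH Suc by auto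
      moreover have "((R j, h x), (Q j, f (x \<otimes> inv (c j)))) \<in> parcs derived"
        using arc[of "R j" x "Q j" "inv (c j)"] x j IH Suc by auto
      then have "f (x \<otimes> inv (c j)) = h x \<otimes> inv (c j)"
        using Suc j by (auto simp: arc_derived_iff)
      then have "\<phi> (R (Suc j), x) \<noteq> (Q j, h x \<otimes> inv (c j))"
        using inj[of "R (Suc j)" x "Q j" "x \<otimes> inv (c j)"] IH(1)[of j "x \<otimes> inv (c j)"] x j by auto
      moreover have "\<phi> (R (Suc j), x) \<noteq> (R i, h x)"
        using inj[of "R (Suc j)" x "R i" x] IH(2)[of i x] x j Suc by auto
      ultimately have "\<phi> (R (Suc j), x) = (R (Suc j), h x)"
        using fG[OF x] Suc j by (cases "\<phi> (R (Suc j), x)") (auto simp: arc_derived_iff)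
      with A show ?thesis by simp
    qed
    with IH show ?case by (auto simp: le_Suc_eq)
  qed
  have QR: "\<phi> (Q j, x) = (Q j, f x)" "\<phi> (R j, x) = (R j, h x)" if "j \<le> m" "x \<in> carrier G" for j x
    using level[of m] that by auto
  have hf: "h x = f x" if x: "x \<in> carrier G" for x
    using link
  proof
    assume "m = 1 \<and> c 1 \<noteq> a"
    then have *: "c 1 \<noteq> a" "1 \<le> m" "m \<le> Suc 0" by auto
    then have top: "top_level (Suc 0)" by (simp only: top_level_def)
    have "((Q 1, f x), (R 1, h x)) \<in> parcs derived"
      using arc1[of "Q 1" x "R 1"] x *(2) top QR by auto
    then have 1: "h x = f x \<or> h x = f x \<otimes> c 1"
      using *(2) top fG[OF x] by (auto simp: arc_derived_iff)
    have "((R 0, h x), \<phi> (T1, x)) \<in> parcs derived"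
      using arc1[of "R 0" x T1] x R0 by auto
    then have "f x = h x \<or> f x = h x \<otimes> inv a"
      using T[of T1 x] x fG[OF x] by (auto simp: arc_derived_iff)
    then have "h x = f x \<or> h x = f x \<otimes> a" using fG[OF x] by (auto simp: m_assoc)
    with 1 show ?thesis using * fG[OF x] by auto
  next
    assume *: "2 \<le> m \<and> c 1 = \<one>"
    have "((Q 1, f x), (R 1, h x)) \<in> parcs derived"
      using arc1[of "Q 1" x "R 1"] x * QR by auto
    then show ?thesis
      using * fG[OF x] by (auto simp: arc_derived_iff)
  qed
  \<comment> \<open>The only automorphism of the triangle that is not excluded so far exchanges its nodes over
     T1 and T3. It cannot keep the node over R 0, which is adjacent to T1 in the same copy and to T3
     in another.\<close>
  have T1: "\<phi> (T1, x) = (T1, f x)" if x: "x \<in> carrier G" for x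
  proof -
    have "((R 0, f x), \<phi> (T1, x)) \<in> parcs derived"
      using arc1[of "R 0" x T1] x R0 hf by auto
    then have "\<phi> (T1, x) \<noteq> (T3, f x)"
      using fG[OF x] by (auto simp: arc_derived_iff)
    then show ?thesis using T[of T1 x] x by auto
  qed
  have T3: "\<phi> (T3, x) = (T3, f x)" if x: "x \<in> carrier G" for x
    using T[of T3 x] T1[of x] inj[of T3 x T1 x] x by auto
  have "\<phi> (k, x) = (k, f x)" if "k \<in> sites" "x \<in> carrier G" for k x
    using that QR hf T1 T3 by (cases k) auto
  then show ?thesis by blast
qed

lemma Aut_ladder: "Aut_graph derived \<cong> G"
proof (rule Aut_derived)
  fix k l v w assume "k \<in> sites" "(l, v) \<in> darts k" "(l, w) \<in> darts k"
  then show "v = w \<or> v = \<one> \<or> w = \<one>"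
    by (cases k rule: ladder_site_cases) (auto split: if_splits)
next
  let ?S = "\<Union>k \<in> sites. snd ` darts k"
  have "a \<in> ?S" by (rule UN_I[of T3]) auto
  moreover have "c j \<in> ?S" if "j \<in> {1..m}" for j
  proof (rule UN_I[of "Q j"])
    show "Q j \<in> sites" using that by simp
    show "c j \<in> snd ` darts (Q j)"
      using that by (cases j) (auto intro!: rev_image_eqI[of "(R j, c j)"])
  qed
  ultimately have "insert a (c ` {1..m}) \<subseteq> ?S" by blast
  then have "carrier G \<subseteq> generate G ?S" using mono_generate gen by metis
  moreover have "?S \<subseteq> carrier G" using dart_closed by fastforce
  then have "generate G ?S \<subseteq> carrier G" by (rule generate_incl)
  ultimately show "generate G ?S = carrier G" by simp
qed (rule ladder_rigid)

end

section \<open>Two small base graphs\<close>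

text \<open>
  The sites are numbered, and \<open>ds ! k\<close> lists the darts that leave \<open>k\<close>, so that the numbers of
  walks into triangles can be computed for all sites at once. One step goes from the numbers for length
  \<open>r\<close> to those for length \<open>r + 1\<close>.
\<close>

definition walk_step :: "(nat \<times> 'a) list list \<Rightarrow> nat list \<Rightarrow> nat list" where
  "walk_step ds xs = map (\<lambda>d. \<Sum>(l, v)\<leftarrow>d. xs ! l) ds"

lemma site_determined_by_walks:
  fixes G :: "('a, 'b) monoid_scheme" (structure)
  assumes vg: "voltage_graph G {..<length ds} (\<lambda>k. set (ds ! k))"
    and ds: "\<forall>d \<in> set ds. distinct d"
    and T: "\<And>k x. \<lbrakk>k < length ds; x \<in> carrier G\<rbrakk> \<Longrightarrow>
      in_triangle (voltage_graph.derived G {..<length ds} (\<lambda>k. set (ds ! k))) (k, x) \<longleftrightarrow> k \<in> T"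
    and inj: "distinct ((walk_step ds ^^ r) (map (\<lambda>k. if k \<in> T then 1 else 0) [0..<length ds]))"
    and \<phi>: "\<phi> \<in> graph_automorphisms (voltage_graph.derived G {..<length ds} (\<lambda>k. set (ds ! k)))"
    and k: "k < length ds" and x: "x \<in> carrier G"
  obtains y where "y \<in> carrier G" "\<phi> (k, x) = (k, y)"
proof -
  interpret voltage_graph G "{..<length ds}" "\<lambda>k. set (ds ! k)" by (rule vg)
  let ?W = "\<lambda>r. (walk_step ds ^^ r) (map (\<lambda>k. if k \<in> T then 1 else 0) [0..<length ds])"
  have len: "length (?W r) = length ds" for r
    by (induction r) (auto simp: walk_step_def)
  have W: "walks T r k = ?W r ! k" if "k < length ds" for r k
    using that
  proof (induction r arbitrary: k)
    case 0
    then show ?case by simp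
  next
    case (Suc r)
    have "walks T (Suc r) k = (\<Sum>(l, v)\<leftarrow>ds ! k. walks T r l)"
      using Suc.prems ds by (simp add: sum_list_distinct_conv_sum_set)
    also have "\<dots> = (\<Sum>(l, v)\<leftarrow>ds ! k. ?W r ! l)"
      using Suc dart_closed[of k] by (intro arg_cong[where f = sum_list] map_cong) auto
    finally show ?case using Suc.prems by (simp add: walk_step_def[of ds "?W r"])
  qed
  obtain l y where ly: "\<phi> (k, x) = (l, y)" by fastforce
  then have l: "l < length ds" "y \<in> carrier G"
    using bij_betw_apply[OF automorphism_bij[OF \<phi>], of "(k, x)"] k x by auto
  have "walks T r l = walks T r k"
    using automorphism_walks[OF \<phi>, of T "(k, x)" r] T k x ly by simp
  then have "l = k" using W k l inj len nth_eq_iff_index_eq by metis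
  then show thesis using that ly l by simp
qed

text \<open>
  An asymmetric cubic graph with 12 nodes. Its only triangle is 0, 1, 11, and the numbers of
  walks of length 6 into it are 253, 251, 217, 208, 160, 116, 145, 125, 157, 151, 159 and 245.
\<close>

definition asymmetric_darts :: "'a \<Rightarrow> (nat \<times> 'a) list list" where
  "asymmetric_darts e = map (map (\<lambda>l. (l, e)))
     [[1, 3, 11], [0, 2, 11], [1, 3, 8], [0, 2, 4], [3, 5, 7], [4, 6, 9],
      [5, 7, 10], [4, 6, 8], [2, 7, 9], [5, 8, 10], [6, 9, 11], [0, 1, 10]]"

lemma trivial_group_graph:
  fixes G :: "('a, 'b) monoid_scheme" (structure)
  assumes "group G" and triv: "carrier G = {\<one>}"
  obtains \<Gamma> :: "(nat \<times> 'a) pair_pre_digraph" where "cubic_graph \<Gamma>" "Aut_graph \<Gamma> \<cong> G"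
proof -
  interpret group G by fact
  define ds where "ds = asymmetric_darts \<one>"
  have len: "length ds = 12" by (simp add: ds_def asymmetric_darts_def)
  have cases: "k = 0 \<or> k = 1 \<or> k = 2 \<or> k = 3 \<or> k = 4 \<or> k = 5 \<or> k = 6 \<or> k = 7 \<or> k = 8
    \<or> k = 9 \<or> k = 10 \<or> k = 11" if "k < 12" for k :: nat
    using that by arith
  have vg: "voltage_graph G {..<length ds} (\<lambda>k. set (ds ! k))"
  proof
    show "finite (carrier G)" "finite {..<length ds}" "{..<length ds} \<noteq> {}"
      by (simp_all add: triv len lessThan_empty_iff)
    fix k assume "k \<in> {..<length ds}"
    then have k: "k < 12" by (simp add: len)
    show "l \<in> {..<length ds} \<and> v \<in> carrier G" if "(l, v) \<in> set (ds ! k)" for l v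
      using cases[OF k] that unfolding len
      by (elim disjE) (auto simp: ds_def asymmetric_darts_def)
    show "(k, inv v) \<in> set (ds ! l)" if "(l, v) \<in> set (ds ! k)" for l v
      using cases[OF k] that
      by (elim disjE) (auto simp: ds_def asymmetric_darts_def)
    show "card (set (ds ! k)) = 3"
      using cases[OF k] by (elim disjE) (auto simp: ds_def asymmetric_darts_def)
    show "(k, \<one>) \<notin> set (ds ! k)"
      using cases[OF k] by (elim disjE) (auto simp: ds_def asymmetric_darts_def)
  qed
  interpret voltage_graph G "{..<length ds}" "\<lambda>k. set (ds ! k)" by (rule vg)
  have tri: "in_triangle derived (k, x) \<longleftrightarrow> k \<in> {0, 1, 11}" if "k < length ds" "x \<in> carrier G" for k x
  proof -
    have "k < 12" using that len by simp
    from cases[OF this] show ?thesis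
      using that(2) in_triangle_derived[of k x] that(1)
      by (elim disjE) (simp_all add: ds_def asymmetric_darts_def)
  qed
  have "Aut_graph derived \<cong> G"
  proof (rule Aut_derived)
    fix \<phi> assume \<phi>: "\<phi> \<in> graph_automorphisms derived"
    have "\<phi> (k, x) = (k, \<one>)" if "k \<in> {..<length ds}" "x \<in> carrier G" for k x
    proof (rule site_determined_by_walks[OF vg _ tri _ \<phi>, of 6 k x])
      show "\<forall>d \<in> set ds. distinct d" by (simp add: ds_def asymmetric_darts_def)
      show "distinct ((walk_step ds ^^ 6) (map (\<lambda>k. if k \<in> {0, 1, 11} then 1 else 0) [0..<length ds]))"
        unfolding len by (simp add: ds_def asymmetric_darts_def walk_step_def eval_nat_numeral upt_rec)
    qed (use that in \<open>auto simp: triv\<close>)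
    then show "\<exists>f. \<forall>k \<in> {..<length ds}. \<forall>x \<in> carrier G. \<phi> (k, x) = (k, f x)"
      by (intro exI[of _ "\<lambda>_. \<one>"]) blast
  next
    fix k l v w assume "k \<in> {..<length ds}" "(l, v) \<in> set (ds ! k)" "(l, w) \<in> set (ds ! k)"
    then show "v = w \<or> v = \<one> \<or> w = \<one>" using dart_closed triv by blast
  next
    show "generate G (\<Union>k \<in> {..<length ds}. snd ` set (ds ! k)) = carrier G"
      using generate_incl[of "\<Union>k \<in> {..<length ds}. snd ` set (ds ! k)"] dart_closed triv generate.one
      by fastforce
  qed
  with cubic_derived that show thesis by blast
qed

text \<open>
  A triangle 0, 1, 2 in which 2 has a loop with voltage \<open>s\<close>; the path 0, 3, 5, 4, 1 with
  a second dart between 3 and 5 and a loop at 4, both with voltage \<open>s\<close>. The numbers of walks of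
  length 4 into the triangle are 47, 46, 50, 29, 35 and 36.
\<close>

definition order_two_darts :: "'a \<Rightarrow> 'a \<Rightarrow> (nat \<times> 'a) list list" where
  "order_two_darts e s =
     [[(1, e), (2, e), (3, e)], [(0, e), (2, e), (4, e)], [(0, e), (1, e), (2, s)],
      [(0, e), (5, e), (5, s)], [(1, e), (5, e), (4, s)], [(3, e), (3, s), (4, e)]]"

text \<open>
  Once sites are known to be preserved, the spanning tree 0-1, 0-2, 0-3, 1-4, 4-5 of darts with voltage
  \<open>\<one>\<close> and without parallels carries the action at one site to all others.
\<close>

lemma order_two_group_graph:
  fixes G :: "('a, 'b) monoid_scheme" (structure)
  assumes "group G" and two: "order G = 2"
  obtains \<Gamma> :: "(nat \<times> 'a) pair_pre_digraph"
  where "cubic_graph \<Gamma>" "Aut_graph \<Gamma> \<cong> G" "card (pverts \<Gamma>) = 6 * order G"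
proof -
  interpret group G by fact
  obtain u v where "carrier G = {u, v}" "u \<noteq> v"
    using two by (auto simp: order_def card_2_iff)
  then obtain s where G: "carrier G = {\<one>, s}" "s \<noteq> \<one>"
    using one_closed by (metis insertE insert_commute singletonD)
  have s: "s \<in> carrier G" using G by simp
  have "s \<otimes> s \<noteq> s" using s G(2) by simp
  then have ss [simp]: "s \<otimes> s = \<one>" using m_closed[OF s s] G by simp
  then have inv_s [simp]: "inv s = s" using s by (simp add: inv_equality)
  note [simp] = s G(2) G(2)[symmetric]
  define ds where "ds = order_two_darts \<one> s"
  have len: "length ds = 6" by (simp add: ds_def order_two_darts_def)
  have cases: "k = 0 \<or> k = 1 \<or> k = 2 \<or> k = 3 \<or> k = 4 \<or> k = 5" if "k < 6" for k :: nat
    using that by arith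
  have vg: "voltage_graph G {..<length ds} (\<lambda>k. set (ds ! k))"
  proof
    show "finite (carrier G)" "finite {..<length ds}" "{..<length ds} \<noteq> {}"
      by (simp_all add: G(1) len lessThan_empty_iff)
    fix k assume "k \<in> {..<length ds}"
    then have k: "k < 6" by (simp add: len)
    show "l \<in> {..<length ds} \<and> v \<in> carrier G" if "(l, v) \<in> set (ds ! k)" for l v
      using cases[OF k] that unfolding len
      by (elim disjE) (auto simp: ds_def order_two_darts_def)
    show "(k, inv v) \<in> set (ds ! l)" if "(l, v) \<in> set (ds ! k)" for l v
      using cases[OF k] that
      by (elim disjE) (auto simp: ds_def order_two_darts_def)
    show "card (set (ds ! k)) = 3"
      using cases[OF k] by (elim disjE) (auto simp: ds_def order_two_darts_def)
    show "(k, \<one>) \<notin> set (ds ! k)"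
      using cases[OF k] by (elim disjE) (auto simp: ds_def order_two_darts_def)
  qed
  interpret voltage_graph G "{..<length ds}" "\<lambda>k. set (ds ! k)" by (rule vg)
  have tri: "in_triangle derived (k, x) \<longleftrightarrow> k \<in> {0, 1, 2}" if "k < length ds" "x \<in> carrier G" for k x
  proof -
    have "k < 6" using that len by simp
    from cases[OF this] show ?thesis
      using that(2) in_triangle_derived[of k x] that(1)
      by (elim disjE) (simp_all add: ds_def order_two_darts_def)
  qed
  have "Aut_graph derived \<cong> G"
  proof (rule Aut_derived)
    fix \<phi> assume \<phi>: "\<phi> \<in> graph_automorphisms derived"
    have site: "\<exists>y \<in> carrier G. \<phi> (k, x) = (k, y)" if "k < 6" "x \<in> carrier G" for k x
    proof (rule site_determined_by_walks[OF vg _ tri _ \<phi>, of 4 k x])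
      show "\<forall>d \<in> set ds. distinct d" by (simp add: ds_def order_two_darts_def)
      show "distinct ((walk_step ds ^^ 4) (map (\<lambda>k. if k \<in> {0, 1, 2} then 1 else 0) [0..<length ds]))"
        unfolding len by (simp add: ds_def order_two_darts_def walk_step_def eval_nat_numeral upt_rec)
    qed (use that len in auto)
    define f where "f x = snd (\<phi> (0, x))" for x
    have step: "\<phi> (l, x) = (l, f x)"
      if "\<phi> (k, x) = (k, f x)" "(l, \<one>) \<in> set (ds ! k)" "\<forall>v. (l, v) \<in> set (ds ! k) \<longrightarrow> v = \<one>"
        "x \<in> carrier G" "k < 6" "l < 6" for k l x
    proof -
      from site[OF \<open>l < 6\<close> \<open>x \<in> carrier G\<close>] obtain y where y: "\<phi> (l, x) = (l, y)" by blast
      have kl: "k < length ds" "l < length ds" using that len by simp_all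
      have fx: "f x \<in> carrier G" using site[of 0 x] that(4) by (auto simp: f_def)
      have "((k, x), (l, x)) \<in> parcs derived"
        unfolding arc_derived_iff using kl that(2,4) r_one[OF that(4)] by force
      then have "(\<phi> (k, x), \<phi> (l, x)) \<in> parcs derived"
        using automorphism_arc_iff[OF \<phi>, of "(k, x)" "(l, x)"] kl \<open>x \<in> carrier G\<close> by simp
      then have "((k, f x), (l, y)) \<in> parcs derived" unfolding that(1) y .
      then obtain v where v: "(l, v) \<in> set (ds ! k)" "y = f x \<otimes> v"
        unfolding arc_derived_iff by blast
      then have "v = \<one>" using that(3) by blast
      then have "y = f x" using v fx by simp
      then show ?thesis using y by simp
    qed
    have "\<phi> (k, x) = (k, f x)" if k: "k < 6" and x: "x \<in> carrier G" for k x
    proof -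
      have 0: "\<phi> (0, x) = (0, f x)" using site[of 0 x] x by (auto simp: f_def)
      note darts = ds_def order_two_darts_def
      have 1: "\<phi> (1, x) = (1, f x)" by (rule step[OF 0]) (use x in \<open>auto simp: darts\<close>)
      have 2: "\<phi> (2, x) = (2, f x)" by (rule step[OF 0]) (use x in \<open>auto simp: darts\<close>)
      have 3: "\<phi> (3, x) = (3, f x)" by (rule step[OF 0]) (use x in \<open>auto simp: darts\<close>)
      have 4: "\<phi> (4, x) = (4, f x)" by (rule step[OF 1]) (use x in \<open>auto simp: darts\<close>)
      have 5: "\<phi> (5, x) = (5, f x)" by (rule step[OF 4]) (use x in \<open>auto simp: darts\<close>)
      show ?thesis using cases[OF k] 0 1 2 3 4 5 by blast
    qed
    then show "\<exists>f. \<forall>k \<in> {..<length ds}. \<forall>x \<in> carrier G. \<phi> (k, x) = (k, f x)"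
      unfolding len by blast
  next
    fix k l v w assume "k \<in> {..<length ds}" "(l, v) \<in> set (ds ! k)" "(l, w) \<in> set (ds ! k)"
    then show "v = w \<or> v = \<one> \<or> w = \<one>" using dart_closed G by blast
  next
    let ?S = "\<Union>k \<in> {..<length ds}. snd ` set (ds ! k)"
    have "(2, s) \<in> set (ds ! 2)" by (simp add: ds_def order_two_darts_def)
    then have "s \<in> ?S" unfolding len by (force intro!: UN_I[of 2])
    then have "{\<one>, s} \<subseteq> generate G ?S"
      using generate.one[of G ?S] generate.incl[of s ?S G] by blast
    moreover have "?S \<subseteq> carrier G" using dart_closed by fastforce
    then have "generate G ?S \<subseteq> carrier G" by (rule generate_incl)
    ultimately show "generate G ?S = carrier G" using G by blast
  qed
  moreover have "card (pverts derived) = 6 * order G" using card_derived len by simp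
  ultimately show thesis using cubic_derived that by blast
qed

section \<open>Choice of the voltages\<close>

lemma nat_graph_with_group:
  assumes "cubic_graph \<Gamma>" "Aut_graph \<Gamma> \<cong> G" "card (pverts \<Gamma>) = N"
  shows "\<exists>\<Delta> :: nat pair_pre_digraph. cubic_graph \<Delta> \<and> Aut_graph \<Delta> \<cong> G \<and> card (pverts \<Delta>) = N"
  using nat_copy[OF assms(1)] assms(2,3) by (metis iso_trans)

text \<open>
  The ladder of height one: the rung and the connection of \<open>R 0\<close> to the triangle carry
  one generator each.
\<close>

lemma two_generator_graph:
  fixes G :: "('a, 'b) monoid_scheme" (structure)
  assumes "group G" "finite (carrier G)" "a \<in> carrier G" "b \<in> carrier G"
    and "a \<noteq> \<one>" "b \<noteq> \<one>" "a \<noteq> b" "generate G {a, b} = carrier G"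
  shows "\<exists>\<Gamma> :: nat pair_pre_digraph. cubic_graph \<Gamma> \<and> Aut_graph \<Gamma> \<cong> G
    \<and> card (pverts \<Gamma>) = 6 * order G"
proof -
  interpret group G by fact
  interpret ladder G 1 a "\<lambda>_. b"
    by unfold_locales (use assms in auto)
  show ?thesis
    using nat_graph_with_group[OF cubic_derived Aut_ladder card_derived]
    by (simp add: card_ladder_sites)
qed

text \<open>
  The lowest rung gets voltage \<open>\<one>\<close>, the top rung and the connection of \<open>R 0\<close> to the
  triangle both get \<open>d\<close>, which must not be \<open>\<one>\<close>, and the \<open>n - 1\<close> rungs in between
  are free for arbitrary elements.
\<close>

lemma many_generator_graph:
  fixes G :: "('a, 'b) monoid_scheme" (structure)
  assumes "group G" "finite (carrier G)" "1 \<le> n" "d \<in> carrier G" "d \<noteq> \<one>"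
    and g: "\<And>i. i \<in> {1..<n} \<Longrightarrow> g i \<in> carrier G"
    and gen: "generate G (insert d (g ` {1..<n})) = carrier G"
  shows "\<exists>\<Gamma> :: nat pair_pre_digraph. cubic_graph \<Gamma> \<and> Aut_graph \<Gamma> \<cong> G
    \<and> card (pverts \<Gamma>) = (2 * n + 6) * order G"
proof -
  interpret group G by fact
  define c where "c j = (if j = n + 1 then d else if j \<in> {2..n} then g (j - 1) else \<one>)" for j
  have c: "c j \<in> carrier G" for j
  proof -
    have "g (j - 1) \<in> carrier G" if "j \<in> {2..n}" using that by (intro g) auto
    then show ?thesis using assms(4) by (auto simp: c_def)
  qed
  have "generate G (insert d (c ` {1..n + 1})) = carrier G"
  proof
    show "generate G (insert d (c ` {1..n + 1})) \<subseteq> carrier G"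
      using c assms by (intro generate_incl) auto
    have "g i \<in> c ` {1..n + 1}" if "i \<in> {1..<n}" for i
      using that by (intro image_eqI[of _ _ "i + 1"]) (auto simp: c_def)
    then have "insert d (g ` {1..<n}) \<subseteq> insert d (c ` {1..n + 1})" by auto
    then show "carrier G \<subseteq> generate G (insert d (c ` {1..n + 1}))"
      using mono_generate gen by metis
  qed
  then interpret ladder G "n + 1" d c
    using assms c by unfold_locales (auto simp: c_def)
  have "card (pverts derived) = (2 * n + 6) * order G"
    unfolding card_derived card_ladder_sites by simp
  from nat_graph_with_group[OF cubic_derived Aut_ladder this] show ?thesis .
qed

lemma (in group) generate_self_inverse:
  assumes u: "u \<in> carrier G" "inv u = u"
  shows "generate G {u} = {\<one>, u}"
proof (intro equalityI subsetI)
  fix h assume "h \<in> generate G {u}"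
  then show "h \<in> {\<one>, u}"
  proof (induction rule: generate.induct)
    case (eng h1 h2)
    moreover have "u \<otimes> u = \<one>" using l_inv[OF u(1)] u(2) by simp
    ultimately show ?case using u by auto
  qed (use u in auto)
qed (use generate.one[of G "{u}"] generate.incl[of u "{u}" G] in auto)

theorem theorem4p1:
  fixes G :: "('a, 'b) monoid_scheme" and g :: "nat \<Rightarrow> 'a" and n :: nat
  assumes "group G"
    and "finite (carrier G)"
    and "\<forall>i \<in> {1..n}. g i \<in> carrier G"
    and "inj_on g {1..n}"
    and "generate G (g ` {1..n}) = carrier G"
  shows "(\<exists>\<Gamma> :: nat pair_pre_digraph. cubic_graph \<Gamma> \<and> Aut_graph \<Gamma> \<cong> G)
    \<and> (n = 2 \<longrightarrow> (\<exists>\<Gamma> :: nat pair_pre_digraph. cubic_graph \<Gamma> \<and> Aut_graph \<Gamma> \<cong> G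
          \<and> card (pverts \<Gamma>) = 6 * order G))
    \<and> (n > 2 \<longrightarrow> (\<exists>\<Gamma> :: nat pair_pre_digraph. cubic_graph \<Gamma> \<and> Aut_graph \<Gamma> \<cong> G
          \<and> card (pverts \<Gamma>) = (2 * n + 6) * order G))"
proof (intro conjI impI)
  interpret group G by fact
  have g: "g i \<in> carrier G" if "i \<in> {1..n}" for i
    using assms(3) that by blast
  note gen = assms(5)
  show "\<exists>\<Gamma> :: nat pair_pre_digraph. cubic_graph \<Gamma> \<and> Aut_graph \<Gamma> \<cong> G"
  proof (cases "carrier G = {\<one>\<^bsub>G\<^esub>}")
    case True
    from trivial_group_graph[OF assms(1) True] show ?thesis
      using nat_graph_with_group by metis
  next
    case False
    then obtain d where d: "d \<in> carrier G" "d \<noteq> \<one>\<^bsub>G\<^esub>" using one_closed by blast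
    have n: "{1..<n + 1} = {1..n}" by auto
    \<comment> \<open>Any element other than 1 may serve as an additional generator, at the cost of two more sites.\<close>
    have "g ` {1..n} \<subseteq> insert d (g ` {1..n})" by blast
    then have "carrier G \<subseteq> generate G (insert d (g ` {1..n}))"
      using mono_generate gen by metis
    moreover have "generate G (insert d (g ` {1..n})) \<subseteq> carrier G"
      using d g by (intro generate_incl) auto
    ultimately have "generate G (insert d (g ` {1..<n + 1})) = carrier G" unfolding n by blast
    from many_generator_graph[OF assms(1,2) _ d _ this] g n show ?thesis by auto
  qed
  show "\<exists>\<Gamma> :: nat pair_pre_digraph. cubic_graph \<Gamma> \<and> Aut_graph \<Gamma> \<cong> G
      \<and> card (pverts \<Gamma>) = 6 * order G" if n: "n = 2"
  proof -
    have "{1..n} = {1, 2}" using n by auto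
    then have g12: "g 1 \<in> carrier G" "g 2 \<in> carrier G" "g 1 \<noteq> g 2" "generate G {g 1, g 2} = carrier G"
      using g assms(4) gen by auto
    consider "g 1 \<noteq> \<one>\<^bsub>G\<^esub>" "g 2 \<noteq> \<one>\<^bsub>G\<^esub>" | "order G = 2"
      | u where "u \<in> carrier G" "u \<noteq> \<one>\<^bsub>G\<^esub>" "{g 1, g 2} = {\<one>\<^bsub>G\<^esub>, u}" "order G \<noteq> 2"
      using g12 by (metis insert_commute)
    then show ?thesis
    proof cases
      case 1
      then show ?thesis using two_generator_graph[OF assms(1,2)] g12 by blast
    next
      case 2
      from order_two_group_graph[OF assms(1) 2] show ?thesis
        using nat_graph_with_group by metis
    next
      case 3
      then have iu: "inv\<^bsub>G\<^esub> u \<in> carrier G" by simp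
      have "{\<one>\<^bsub>G\<^esub>, u} \<subseteq> generate G {u}" using generate.one[of G "{u}"] generate.incl[of u "{u}" G] by auto
      then have "generate G {\<one>\<^bsub>G\<^esub>, u} \<subseteq> generate G {u}"
        using 3(1) by (intro generate_subgroup_incl generate_is_subgroup) auto
      then have u: "carrier G = generate G {u}"
        using 3 g12(4) generate_incl[of "{u}"] by auto
      \<comment> \<open>G is cyclic; the pair of u and its inverse generates it as well.\<close>
      have "inv\<^bsub>G\<^esub> u \<noteq> u"
      proof
        assume "inv\<^bsub>G\<^esub> u = u"
        then have "carrier G = {\<one>\<^bsub>G\<^esub>, u}" using u generate_self_inverse[OF 3(1)] by simp
        then have "order G = card {\<one>\<^bsub>G\<^esub>, u}" unfolding order_def by (rule arg_cong)
        then show False using 3(2,4) by simp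
      qed
      moreover have "inv\<^bsub>G\<^esub> u \<noteq> \<one>\<^bsub>G\<^esub>" using 3(1,2) by (metis inv_inv inv_one)
      moreover have "generate G {u, inv\<^bsub>G\<^esub> u} = carrier G"
        using u mono_generate[of "{u}" "{u, inv\<^bsub>G\<^esub> u}"] generate_incl[of "{u, inv\<^bsub>G\<^esub> u}"] 3(1) iu by auto
      ultimately show ?thesis
        using two_generator_graph[OF assms(1,2) 3(1) iu 3(2)] by metis
    qed
  qed
  show "\<exists>\<Gamma> :: nat pair_pre_digraph. cubic_graph \<Gamma> \<and> Aut_graph \<Gamma> \<cong> G
      \<and> card (pverts \<Gamma>) = (2 * n + 6) * order G" if n: "n > 2"
  proof -
    \<comment> \<open>The generator named d is used in the two places where 1 is not admitted. If g n is 1, it can be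
       left out, and g 1 takes its place.\<close>
    define d where "d = (if g n = \<one>\<^bsub>G\<^esub> then g 1 else g n)"
    have d: "d \<in> carrier G" using g n by (simp add: d_def)
    have "g 1 \<noteq> g n" using inj_onD[OF assms(4), of 1 n] n by auto
    then have d1: "d \<noteq> \<one>\<^bsub>G\<^esub>" by (auto simp: d_def)
    let ?S = "insert d (g ` {1..<n})"
    have S: "?S \<subseteq> carrier G" using d g by auto
    have "g i \<in> generate G ?S" if i: "i \<in> {1..n}" for i
    proof (cases "i = n")
      case True
      show ?thesis
      proof (cases "g n = \<one>\<^bsub>G\<^esub>")
        case one: True
        then show ?thesis using \<open>i = n\<close> generate.one[of G ?S] by simp
      next
        case False
        then have "g i = d" using \<open>i = n\<close> by (simp add: d_def)
        then show ?thesis using generate.incl[of d ?S G] by simp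
      qed
    next
      case False
      with i have "g i \<in> ?S" by auto
      then show ?thesis by (rule generate.incl)
    qed
    then have "generate G (g ` {1..n}) \<subseteq> generate G ?S"
      using S by (intro generate_subgroup_incl generate_is_subgroup) auto
    then have "generate G ?S = carrier G"
      using gen generate_incl[OF S] by blast
    then show ?thesis
      using many_generator_graph[OF assms(1,2) _ d d1, of n g] g n by auto
  qed
qed

end
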